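(* The class $B_n(X\times X)$ can contain a Cauchy sequence whose limit is not an $n$-bounded bigroup homomorphism. That is, there exist a topological ring $R$, a topological module $X$ over $R$, a sequence $(\sigma_k)_{k\in\mathbb N}$ of $n$-bounded bigroup homomorphisms $X\times X\to X$ that is Cauchy with respect to uniform convergence on some zero neighborhoods, and a bigroup homomorphism $\sigma:X\times X\to X$ such that $\sigma_k\to\sigma$ uniformly on some zero neighborhoods, but $\sigma$ is not $n$-bounded.
   Context: A topological module $X$ over a topological ring $R$ is an $R$-module with a topology making $X$ a topological additive group and making the multiplication $R\times X\to X$ (jointly) continuous. A zero neighborhood is a neighborhood of $0$. A set $B\subseteq X$ is bounded if for each zero neighborhood $W\subseteq X$ there is a zero neighborhood $V\subseteq R$ such that $VB\subseteq W$, where $VB=\{vb: v\in V, b\in B\}$. A bigroup homomorphism $\sigma:X\times X\to X$ is a map that is a homomorphism of additive groups in each variable separately. For $A,B\subseteq X$, $\sigma(A,B)=\{\sigma(a,b):a\in A,b\in B\}$. $\sigma$ is $n$-bounded (the letter $n$ is part of the name) if there exist zero neighborhoods $U,V\subseteq X$ such that $\sigma(U,V)$ is bounded in $X$; $B_n(X\times X)$ is the set of all such $\sigma$. A sequence $(\sigma_k)$ of bigroup homomorphisms converges to $\sigma$ uniformly on some zero neighborhoods if there exist zero neighborhoods $U,V\subseteq X$ such that for each zero neighborhood $W\subseteq X$ there is $k_0$ with $(\sigma_k-\sigma)(U,V)\subseteq W$ for all $k\ge k_0$. It is Cauchy in this sense if there exist zero neighborhoods $U,V\subseteq X$ such that for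 each zero neighborhood $W\subseteq X$ there is $k_0$ with $(\sigma_k-\sigma_m)(U,V)\subseteq W$ for all $k,m\ge k_0$. *)

theory Defs
  imports "HOL-Analysis.Analysis" "HOL-Algebra.Module"
begin

locale topological_ring = ring R
  for R :: "('r, 'm) ring_scheme" (structure) and TR :: "'r topology" +
  assumes topspace_ring: "topspace TR = carrier R"
    and continuous_ring_add: "continuous_map (prod_topology TR TR) TR (\<lambda>(a, b). a \<oplus> b)"
    and continuous_ring_minus: "continuous_map TR TR (\<lambda>a. \<ominus> a)"
    and continuous_ring_mult: "continuous_map (prod_topology TR TR) TR (\<lambda>(a, b). a \<otimes> b)"

(* The module locale of HOL-Algebra requires a commutative ring of scalars; the axioms of a
   (left, unital) module are therefore restated here over an arbitrary ring.  Of the record X only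
   the additive structure and the scalar multiplication are relevant. *)
locale topological_module =
  topological_ring R TR + X?: abelian_group X
  for R :: "('r, 'm) ring_scheme" (structure) and TR :: "'r topology"
    and X :: "('r, 'x, 'n) module_scheme" (structure) and TX :: "'x topology" +
  assumes smult_closed: "\<lbrakk>a \<in> carrier R; x \<in> carrier X\<rbrakk> \<Longrightarrow> a \<odot>\<^bsub>X\<^esub> x \<in> carrier X"
    and smult_l_distr: "\<lbrakk>a \<in> carrier R; b \<in> carrier R; x \<in> carrier X\<rbrakk> \<Longrightarrow>
          (a \<oplus>\<^bsub>R\<^esub> b) \<odot>\<^bsub>X\<^esub> x = a \<odot>\<^bsub>X\<^esub> x \<oplus>\<^bsub>X\<^esub> b \<odot>\<^bsub>X\<^esub> x"
    and smult_r_distr: "\<lbrakk>a \<in> carrier R; x \<in> carrier X; y \<in> carrier X\<rbrakk> \<Longrightarrow>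
          a \<odot>\<^bsub>X\<^esub> (x \<oplus>\<^bsub>X\<^esub> y) = a \<odot>\<^bsub>X\<^esub> x \<oplus>\<^bsub>X\<^esub> a \<odot>\<^bsub>X\<^esub> y"
    and smult_assoc: "\<lbrakk>a \<in> carrier R; b \<in> carrier R; x \<in> carrier X\<rbrakk> \<Longrightarrow>
          (a \<otimes>\<^bsub>R\<^esub> b) \<odot>\<^bsub>X\<^esub> x = a \<odot>\<^bsub>X\<^esub> (b \<odot>\<^bsub>X\<^esub> x)"
    and smult_one: "x \<in> carrier X \<Longrightarrow> \<one>\<^bsub>R\<^esub> \<odot>\<^bsub>X\<^esub> x = x"
    and topspace_module: "topspace TX = carrier X"
    and continuous_module_add: "continuous_map (prod_topology TX TX) TX (\<lambda>(x, y). x \<oplus>\<^bsub>X\<^esub> y)"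
    and continuous_module_minus: "continuous_map TX TX (\<lambda>x. \<ominus>\<^bsub>X\<^esub> x)"
    and continuous_smult: "continuous_map (prod_topology TR TX) TX (\<lambda>(a, x). a \<odot>\<^bsub>X\<^esub> x)"

definition zero_nbhd :: "('a, 'm) ring_scheme \<Rightarrow> 'a topology \<Rightarrow> 'a set \<Rightarrow> bool" where
  "zero_nbhd A T N \<longleftrightarrow> N \<subseteq> topspace T \<and> (\<exists>G. openin T G \<and> \<zero>\<^bsub>A\<^esub> \<in> G \<and> G \<subseteq> N)"

definition bounded_set ::
  "('r, 'm) ring_scheme \<Rightarrow> 'r topology \<Rightarrow> ('r, 'x, 'n) module_scheme \<Rightarrow> 'x topology \<Rightarrow> 'x set \<Rightarrow> bool" where
  "bounded_set R TR X TX B \<longleftrightarrow> B \<subseteq> carrier X \<and>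
     (\<forall>W. zero_nbhd X TX W \<longrightarrow>
        (\<exists>V. zero_nbhd R TR V \<and> {v \<odot>\<^bsub>X\<^esub> b | v b. v \<in> V \<and> b \<in> B} \<subseteq> W))"

definition bigroup_hom :: "('x, 'n) ring_scheme \<Rightarrow> ('x \<times> 'x \<Rightarrow> 'x) \<Rightarrow> bool" where
  "bigroup_hom X \<sigma> \<longleftrightarrow>
     (\<forall>y\<in>carrier X. (\<lambda>x. \<sigma> (x, y)) \<in> hom (add_monoid X) (add_monoid X)) \<and>
     (\<forall>x\<in>carrier X. (\<lambda>y. \<sigma> (x, y)) \<in> hom (add_monoid X) (add_monoid X))"

definition n_bounded ::
  "('r, 'm) ring_scheme \<Rightarrow> 'r topology \<Rightarrow> ('r, 'x, 'n) module_scheme \<Rightarrow> 'x topology \<Rightarrow>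
     ('x \<times> 'x \<Rightarrow> 'x) \<Rightarrow> bool" where
  "n_bounded R TR X TX \<sigma> \<longleftrightarrow>
     (\<exists>U V. zero_nbhd X TX U \<and> zero_nbhd X TX V \<and> bounded_set R TR X TX (\<sigma> ` (U \<times> V)))"

definition B_n ::
  "('r, 'm) ring_scheme \<Rightarrow> 'r topology \<Rightarrow> ('r, 'x, 'n) module_scheme \<Rightarrow> 'x topology \<Rightarrow>
     ('x \<times> 'x \<Rightarrow> 'x) set" where
  "B_n R TR X TX = {\<sigma>. bigroup_hom X \<sigma> \<and> n_bounded R TR X TX \<sigma>}"

definition converges_on_zero_nbhds ::
  "('x, 'n) ring_scheme \<Rightarrow> 'x topology \<Rightarrow> (nat \<Rightarrow> 'x \<times> 'x \<Rightarrow> 'x) \<Rightarrow> ('x \<times> 'x \<Rightarrow> 'x) \<Rightarrow> bool" where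
  "converges_on_zero_nbhds X TX \<sigma>s \<sigma> \<longleftrightarrow>
     (\<exists>U V. zero_nbhd X TX U \<and> zero_nbhd X TX V \<and>
        (\<forall>W. zero_nbhd X TX W \<longrightarrow>
           (\<exists>k0. \<forall>k\<ge>k0. (\<lambda>p. \<sigma>s k p \<ominus>\<^bsub>X\<^esub> \<sigma> p) ` (U \<times> V) \<subseteq> W)))"

definition Cauchy_on_zero_nbhds ::
  "('x, 'n) ring_scheme \<Rightarrow> 'x topology \<Rightarrow> (nat \<Rightarrow> 'x \<times> 'x \<Rightarrow> 'x) \<Rightarrow> bool" where
  "Cauchy_on_zero_nbhds X TX \<sigma>s \<longleftrightarrow>
     (\<exists>U V. zero_nbhd X TX U \<and> zero_nbhd X TX V \<and>
        (\<forall>W. zero_nbhd X TX W \<longrightarrow>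
           (\<exists>k0. \<forall>k\<ge>k0. \<forall>m\<ge>k0. (\<lambda>p. \<sigma>s k p \<ominus>\<^bsub>X\<^esub> \<sigma>s m p) ` (U \<times> V) \<subseteq> W)))"

end

theory Submission imports Defs begin

text \<open>
  Take for \<open>R\<close> the ring of real sequences with pointwise operations and the product topology, and
  for \<open>X\<close> this ring regarded as a module over itself. A neighborhood of zero constrains only finitely
  many coordinates, and it constrains each of them only up to some \<open>\<epsilon> > 0\<close>. The pointwise product
  \<open>\<sigma>\<close> is therefore not \<open>n\<close>-bounded: for any zero neighborhoods \<open>U\<close> and \<open>V\<close> some coordinate is free in
  both, so \<open>\<sigma>(U, V)\<close> contains every multiple of the corresponding unit vector, and no zero
  neighborhood of scalars, which always contains some \<open>v\<close> whose value at that coordinate is nonzero,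
  can shrink all of them (\<open>not_n_bounded_pointwise_product\<close>).

  The products \<open>\<sigma>\<^sub>k\<close> truncated to the coordinates below \<open>k\<close> are \<open>n\<close>-bounded, since it is enough to
  constrain those \<open>k\<close> coordinates in both arguments (\<open>n_bounded_truncated_product\<close>). Finally,
  \<open>\<sigma>\<^sub>k - \<sigma>\<close> vanishes at the coordinates below \<open>k\<close>, so for large \<open>k\<close> it maps everything into a given
  zero neighborhood: the convergence is uniform even on the whole of \<open>X \<times> X\<close>.
\<close>

section \<open>Real sequences as a ring and as a module over itself\<close>

definition seq_ring :: "(nat \<Rightarrow> real) ring" where
  "seq_ring = \<lparr>carrier = UNIV, mult = (\<lambda>x y i. x i * y i), one = (\<lambda>i. 1),
     zero = (\<lambda>i. 0), add = (\<lambda>x y i. x i + y i)\<rparr>"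

definition seq_module :: "(nat \<Rightarrow> real, nat \<Rightarrow> real) module" where
  "seq_module = ring.extend seq_ring \<lparr>smult = (\<lambda>x y i. x i * y i)\<rparr>"

definition truncated_product :: "nat \<Rightarrow> (nat \<Rightarrow> real) \<times> (nat \<Rightarrow> real) \<Rightarrow> (nat \<Rightarrow> real)" where
  "truncated_product k = (\<lambda>(x, y) i. if i < k then x i * y i else 0)"

definition pointwise_product :: "(nat \<Rightarrow> real) \<times> (nat \<Rightarrow> real) \<Rightarrow> (nat \<Rightarrow> real)" where
  "pointwise_product = (\<lambda>(x, y) i. x i * y i)"

definition cylinder :: "nat \<Rightarrow> real \<Rightarrow> (nat \<Rightarrow> real) set" where
  "cylinder n e = {x. \<forall>i<n. \<bar>x i\<bar> < e}"

lemma seq_ring_simps [simp]: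
  "carrier seq_ring = UNIV"
  "x \<otimes>\<^bsub>seq_ring\<^esub> y = (\<lambda>i. x i * y i)"
  "x \<oplus>\<^bsub>seq_ring\<^esub> y = (\<lambda>i. x i + y i)"
  "\<one>\<^bsub>seq_ring\<^esub> = (\<lambda>i. 1)"
  "\<zero>\<^bsub>seq_ring\<^esub> = (\<lambda>i. 0)"
  by (simp_all add: seq_ring_def)

lemma seq_module_simps [simp]:
  "carrier seq_module = UNIV"
  "x \<odot>\<^bsub>seq_module\<^esub> y = (\<lambda>i. x i * y i)"
  "x \<oplus>\<^bsub>seq_module\<^esub> y = (\<lambda>i. x i + y i)"
  "\<zero>\<^bsub>seq_module\<^esub> = (\<lambda>i. 0)"
  by (simp_all add: seq_module_def seq_ring_def ring.extend_def)

lemma ring_seq_ring: "ring seq_ring"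
proof (rule ringI)
  show "abelian_group seq_ring"
  proof (rule abelian_groupI)
    fix x :: "nat \<Rightarrow> real"
    show "\<exists>y\<in>carrier seq_ring. y \<oplus>\<^bsub>seq_ring\<^esub> x = \<zero>\<^bsub>seq_ring\<^esub>"
      by (rule bexI[of _ "\<lambda>i. - x i"]) auto
  qed (auto simp: algebra_simps)
  show "Group.monoid seq_ring"
    by (rule monoidI) (auto simp: algebra_simps)
qed (auto simp: algebra_simps)

lemma abelian_group_seq_module: "abelian_group seq_module"
proof (rule abelian_groupI)
  fix x :: "nat \<Rightarrow> real"
  show "\<exists>y\<in>carrier seq_module. y \<oplus>\<^bsub>seq_module\<^esub> x = \<zero>\<^bsub>seq_module\<^esub>"
    by (rule bexI[of _ "\<lambda>i. - x i"]) auto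
qed (auto simp: algebra_simps)

lemma seq_ring_minus [simp]: "\<ominus>\<^bsub>seq_ring\<^esub> x = (\<lambda>i. - x i)"
proof -
  interpret ring seq_ring by (rule ring_seq_ring)
  have "\<ominus>\<^bsub>seq_ring\<^esub> x \<oplus>\<^bsub>seq_ring\<^esub> x = \<zero>\<^bsub>seq_ring\<^esub>" by (rule l_neg) simp
  then show ?thesis by (auto simp: fun_eq_iff eq_neg_iff_add_eq_0)
qed

lemma seq_module_minus [simp]: "\<ominus>\<^bsub>seq_module\<^esub> x = (\<lambda>i. - x i)"
proof -
  interpret abelian_group seq_module by (rule abelian_group_seq_module)
  have "\<ominus>\<^bsub>seq_module\<^esub> x \<oplus>\<^bsub>seq_module\<^esub> x = \<zero>\<^bsub>seq_module\<^esub>" by (rule l_neg) simp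
  then show ?thesis by (auto simp: fun_eq_iff eq_neg_iff_add_eq_0)
qed

lemma seq_module_diff [simp]: "x \<ominus>\<^bsub>seq_module\<^esub> y = (\<lambda>i. x i - y i)"
  by (simp add: a_minus_def)

section \<open>Continuity of the pointwise operations\<close>

lemma continuous_on_coordinates:
  "continuous_on S (\<lambda>x :: nat \<Rightarrow> real. x i)"
  "continuous_on T (\<lambda>z :: (nat \<Rightarrow> real) \<times> (nat \<Rightarrow> real). fst z i)"
  "continuous_on T (\<lambda>z :: (nat \<Rightarrow> real) \<times> (nat \<Rightarrow> real). snd z i)"
  by (rule continuous_on_product_then_coordinatewise,
      rule continuous_on_id continuous_on_fst[OF continuous_on_id]
        continuous_on_snd[OF continuous_on_id])+

lemma continuous_map_pointwise:
  fixes f :: "(nat \<Rightarrow> real) \<times> (nat \<Rightarrow> real) \<Rightarrow> nat \<Rightarrow> real"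
  assumes "\<And>i. continuous_on UNIV (\<lambda>z. f z i)"
  shows "continuous_map (prod_topology euclidean euclidean) euclidean f"
  using continuous_on_coordinatewise_then_product[OF assms] by simp

lemma continuous_pointwise_add:
  "continuous_map (prod_topology euclidean euclidean) euclidean
     (\<lambda>(x :: nat \<Rightarrow> real, y :: nat \<Rightarrow> real) i. x i + y i)"
  unfolding case_prod_beta
  by (intro continuous_map_pointwise continuous_on_add continuous_on_coordinates)

lemma continuous_pointwise_mult:
  "continuous_map (prod_topology euclidean euclidean) euclidean
     (\<lambda>(x :: nat \<Rightarrow> real, y :: nat \<Rightarrow> real) i. x i * y i)"
  unfolding case_prod_beta
  by (intro continuous_map_pointwise continuous_on_mult continuous_on_coordinates)

lemma continuous_pointwise_minus:
  "continuous_map euclidean euclidean (\<lambda>(x :: nat \<Rightarrow> real) i. - x i)"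
proof -
  have "continuous_on UNIV (\<lambda>(x :: nat \<Rightarrow> real) i. - x i)"
    by (rule continuous_on_coordinatewise_then_product)
      (rule continuous_on_minus[OF continuous_on_coordinates(1)])
  then show ?thesis by simp
qed

lemma topological_ring_seq_ring: "topological_ring seq_ring euclidean"
  unfolding topological_ring_def topological_ring_axioms_def
  using ring_seq_ring continuous_pointwise_add continuous_pointwise_mult continuous_pointwise_minus
  by simp

lemma topological_module_seq_module:
  "topological_module seq_ring euclidean seq_module euclidean"
  unfolding topological_module_def topological_module_axioms_def
  using topological_ring_seq_ring abelian_group_seq_module
    continuous_pointwise_add continuous_pointwise_mult continuous_pointwise_minus
  by (simp add: algebra_simps)

section \<open>Zero neighborhoods in the product topology\<close>

lemma open_cylinder: "open (cylinder n e)"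
proof -
  have "cylinder n e = (\<Inter>i\<in>{..<n}. {x. \<bar>x i\<bar> < e})"
    by (auto simp: cylinder_def)
  also have "open \<dots>"
    by (intro open_INT ballI open_Collect_less continuous_on_rabs continuous_on_const
        continuous_on_coordinates) auto
  finally show ?thesis .
qed

lemma zero_nbhd_cylinder:
  assumes "\<zero>\<^bsub>A\<^esub> = (\<lambda>i. 0)" and "e > 0"
  shows "zero_nbhd A euclidean (cylinder n e)"
  unfolding zero_nbhd_def using assms open_cylinder[of n e]
  by (auto simp: cylinder_def intro!: exI[of _ "cylinder n e"])

text \<open>
  A basic open set of the product topology restricts only finitely many coordinates; bounding all the
  coordinates up to the last of these by the smallest of the finitely many radii gives a cylinder
  inside it.
\<close>
lemma zero_nbhd_contains_cylinder:
  assumes "zero_nbhd A euclidean W" and "\<zero>\<^bsub>A\<^esub> = (\<lambda>i. 0)"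
  obtains n e where "e > 0" and "cylinder n e \<subseteq> W"
proof -
  obtain G where G: "open G" "(\<lambda>i. 0) \<in> G" "G \<subseteq> W"
    using assms by (auto simp: zero_nbhd_def)
  have "openin (product_topology (\<lambda>i. euclidean) UNIV) G"
    using G(1) by (simp add: open_fun_def)
  from product_topology_open_contains_basis[OF this G(2)]
  obtain Y where Y: "(\<lambda>i. 0) \<in> Pi\<^sub>E UNIV Y" "\<And>i. open (Y i)" "finite {i. Y i \<noteq> UNIV}"
    "Pi\<^sub>E UNIV Y \<subseteq> G"
    by auto
  have "\<forall>i. \<exists>e>0. \<forall>t. \<bar>t\<bar> < e \<longrightarrow> t \<in> Y i"
  proof
    fix i
    have "0 \<in> Y i" using Y(1) by (auto simp: PiE_def Pi_def)
    then obtain e where "e > 0" "ball 0 e \<subseteq> Y i"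
      using Y(2) open_contains_ball by meson
    then show "\<exists>e>0. \<forall>t. \<bar>t\<bar> < e \<longrightarrow> t \<in> Y i" by (auto simp: subset_iff)
  qed
  then obtain r where r: "\<And>i. r i > 0" "\<And>i t. \<bar>t\<bar> < r i \<Longrightarrow> t \<in> Y i" by metis
  obtain n where n: "\<And>i. Y i \<noteq> UNIV \<Longrightarrow> i < n"
    using Y(3) by (auto simp: finite_nat_set_iff_bounded)
  \<comment> \<open>The extra element \<open>1\<close> makes the minimum meaningful when no coordinate is restricted.\<close>
  define e where "e = Min (insert 1 (r ` {..<n}))"
  have "e > 0" using r(1) by (simp add: e_def)
  moreover have "cylinder n e \<subseteq> Pi\<^sub>E UNIV Y"
  proof
    fix x assume x: "x \<in> cylinder n e"
    have "x i \<in> Y i" for i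
    proof (cases "i < n")
      case True
      then have "e \<le> r i" by (simp add: e_def)
      with True x r(2) show ?thesis by (force simp: cylinder_def)
    next
      case False
      with n show ?thesis by blast
    qed
    then show "x \<in> Pi\<^sub>E UNIV Y" by auto
  qed
  ultimately show thesis using that Y(4) G(3) by blast
qed

section \<open>Boundedness of the truncated and full products\<close>

lemma bigroup_hom_truncated_product: "bigroup_hom seq_module (truncated_product k)"
  by (auto simp: bigroup_hom_def hom_def truncated_product_def algebra_simps)

lemma bigroup_hom_pointwise_product: "bigroup_hom seq_module pointwise_product"
  by (auto simp: bigroup_hom_def hom_def pointwise_product_def algebra_simps)

lemma bounded_set_unit_box:
  "bounded_set seq_ring euclidean seq_module euclidean {b. \<forall>i. \<bar>b i\<bar> \<le> 1}"
  unfolding bounded_set_def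
proof (intro conjI allI impI)
  fix W assume "zero_nbhd seq_module euclidean W"
  then obtain n e where e: "e > 0" and W: "cylinder n e \<subseteq> W"
    by (rule zero_nbhd_contains_cylinder) simp
  have "(\<lambda>i. v i * b i) \<in> cylinder n e"
    if "v \<in> cylinder n e" "\<forall>i. \<bar>b i\<bar> \<le> 1" for v b
  proof -
    have "\<bar>v i * b i\<bar> < e" if "i < n" for i
    proof -
      have "\<bar>v i * b i\<bar> \<le> \<bar>v i\<bar>"
        using \<open>\<forall>i. \<bar>b i\<bar> \<le> 1\<close> by (simp add: abs_mult mult_left_le)
      also have "\<dots> < e" using \<open>v \<in> cylinder n e\<close> \<open>i < n\<close> by (simp add: cylinder_def)
      finally show ?thesis .
    qed
    then show ?thesis by (simp add: cylinder_def)
  qed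
  with W have "{v \<odot>\<^bsub>seq_module\<^esub> b | v b. v \<in> cylinder n e \<and> b \<in> {b. \<forall>i. \<bar>b i\<bar> \<le> 1}} \<subseteq> W"
    by auto
  with zero_nbhd_cylinder[of seq_ring e n] e
  show "\<exists>V. zero_nbhd seq_ring euclidean V \<and>
      {v \<odot>\<^bsub>seq_module\<^esub> b | v b. v \<in> V \<and> b \<in> {b. \<forall>i. \<bar>b i\<bar> \<le> 1}} \<subseteq> W"
    by auto
qed simp

lemma bounded_set_subset:
  assumes "bounded_set R TR X TX B" and "C \<subseteq> B"
  shows "bounded_set R TR X TX C"
  unfolding bounded_set_def
proof (intro conjI allI impI)
  show "C \<subseteq> carrier X" using assms by (auto simp: bounded_set_def)
  fix W assume "zero_nbhd X TX W"
  then obtain V where "zero_nbhd R TR V" "{v \<odot>\<^bsub>X\<^esub> b | v b. v \<in> V \<and> b \<in> B} \<subseteq> W"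
    using assms(1) by (auto simp: bounded_set_def)
  moreover have "{v \<odot>\<^bsub>X\<^esub> b | v b. v \<in> V \<and> b \<in> C} \<subseteq> {v \<odot>\<^bsub>X\<^esub> b | v b. v \<in> V \<and> b \<in> B}"
    using assms(2) by blast
  ultimately show "\<exists>V. zero_nbhd R TR V \<and> {v \<odot>\<^bsub>X\<^esub> b | v b. v \<in> V \<and> b \<in> C} \<subseteq> W"
    by blast
qed

text \<open>
  Only the coordinates below \<open>k\<close> survive truncation, so keeping these small in both arguments keeps
  the whole product in the unit box.
\<close>
lemma n_bounded_truncated_product:
  "n_bounded seq_ring euclidean seq_module euclidean (truncated_product k)"
proof -
  have "truncated_product k ` (cylinder k 1 \<times> cylinder k 1) \<subseteq> {b. \<forall>i. \<bar>b i\<bar> \<le> 1}"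
    by (auto simp: truncated_product_def cylinder_def abs_mult mult_le_one less_imp_le)
  then have "bounded_set seq_ring euclidean seq_module euclidean
      (truncated_product k ` (cylinder k 1 \<times> cylinder k 1))"
    by (rule bounded_set_subset[OF bounded_set_unit_box])
  with zero_nbhd_cylinder[of seq_module 1 k] show ?thesis
    unfolding n_bounded_def by auto
qed

text \<open>
  If \<open>U\<close> and \<open>V\<close> contain cylinders over the first \<open>m\<close> and \<open>n\<close> coordinates, then coordinate
  \<open>N = max m n\<close> is free in both. A neighborhood of scalars contains some \<open>v\<close> with \<open>v N \<noteq> 0\<close>, and it sends
  the element of \<open>\<sigma>(U, V)\<close> with \<open>N\<close>-th entry \<open>1 / v N\<close> to one with \<open>N\<close>-th entry \<open>1\<close>.
\<close>
lemma not_n_bounded_pointwise_product: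
  "\<not> n_bounded seq_ring euclidean seq_module euclidean pointwise_product"
proof
  assume "n_bounded seq_ring euclidean seq_module euclidean pointwise_product"
  then obtain U V where U: "zero_nbhd seq_module euclidean U" and V: "zero_nbhd seq_module euclidean V"
    and bounded: "bounded_set seq_ring euclidean seq_module euclidean (pointwise_product ` (U \<times> V))"
    unfolding n_bounded_def by blast
  obtain m d where d: "d > 0" "cylinder m d \<subseteq> U"
    using U by (rule zero_nbhd_contains_cylinder) simp
  obtain n e where e: "e > 0" "cylinder n e \<subseteq> V"
    using V by (rule zero_nbhd_contains_cylinder) simp
  define N where "N = max m n"
  have "zero_nbhd seq_module euclidean (cylinder (Suc N) 1)"
    by (rule zero_nbhd_cylinder) auto
  with bounded obtain S where S: "zero_nbhd seq_ring euclidean S"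
    and shrink: "{v \<odot>\<^bsub>seq_module\<^esub> b | v b. v \<in> S \<and> b \<in> pointwise_product ` (U \<times> V)}
      \<subseteq> cylinder (Suc N) 1"
    unfolding bounded_set_def by blast
  obtain l r where r: "r > 0" "cylinder l r \<subseteq> S"
    using S by (rule zero_nbhd_contains_cylinder) simp
  define v where "v = (\<lambda>i::nat. r / 2)"
  define x where "x = (\<lambda>i. if i = N then 2 / r else 0)"
  define y where "y = (\<lambda>i. if i = N then 1 else 0 :: real)"
  have "v \<in> cylinder l r" using r(1) by (simp add: v_def cylinder_def)
  moreover have "x \<in> cylinder m d" using d(1) by (simp add: x_def cylinder_def N_def)
  moreover have "y \<in> cylinder n e" using e(1) by (simp add: y_def cylinder_def N_def)
  ultimately have "v \<in> S" "x \<in> U" "y \<in> V" using r(2) d(2) e(2) by auto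
  then have "v \<odot>\<^bsub>seq_module\<^esub> pointwise_product (x, y) \<in> cylinder (Suc N) 1"
    using shrink by blast
  then have "\<bar>v N * (x N * y N)\<bar> < 1"
    by (auto simp: pointwise_product_def cylinder_def)
  then show False using r(1) by (simp add: v_def x_def y_def)
qed

section \<open>Uniform convergence of the truncations\<close>

lemma zero_nbhd_contains_tail_sequences:
  assumes "zero_nbhd seq_module euclidean W"
  shows "\<exists>n. \<forall>x. (\<forall>i<n. x i = 0) \<longrightarrow> x \<in> W"
proof -
  obtain n e where "e > 0" "cylinder n e \<subseteq> W"
    using assms by (rule zero_nbhd_contains_cylinder) simp
  then show ?thesis by (intro exI[of _ n]) (auto simp: cylinder_def)
qed

lemma zero_nbhd_UNIV: "zero_nbhd seq_module euclidean UNIV"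
  by (auto simp: zero_nbhd_def)

lemma truncated_product_converges:
  "converges_on_zero_nbhds seq_module euclidean truncated_product pointwise_product"
  unfolding converges_on_zero_nbhds_def
proof (rule exI[of _ UNIV], rule exI[of _ UNIV], intro conjI allI impI zero_nbhd_UNIV)
  fix W assume "zero_nbhd seq_module euclidean W"
  then obtain n where n: "\<And>x. \<forall>i<n. x i = 0 \<Longrightarrow> x \<in> W"
    using zero_nbhd_contains_tail_sequences by blast
  show "\<exists>k0. \<forall>k\<ge>k0.
      (\<lambda>p. truncated_product k p \<ominus>\<^bsub>seq_module\<^esub> pointwise_product p) ` (UNIV \<times> UNIV) \<subseteq> W"
    by (intro exI[of _ n]) (auto 0 0 simp: truncated_product_def pointwise_product_def intro!: n)
qed

lemma Cauchy_truncated_product: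
  "Cauchy_on_zero_nbhds seq_module euclidean truncated_product"
  unfolding Cauchy_on_zero_nbhds_def
proof (rule exI[of _ UNIV], rule exI[of _ UNIV], intro conjI allI impI zero_nbhd_UNIV)
  fix W assume "zero_nbhd seq_module euclidean W"
  then obtain n where n: "\<And>x. \<forall>i<n. x i = 0 \<Longrightarrow> x \<in> W"
    using zero_nbhd_contains_tail_sequences by blast
  show "\<exists>k0. \<forall>k\<ge>k0. \<forall>m\<ge>k0.
      (\<lambda>p. truncated_product k p \<ominus>\<^bsub>seq_module\<^esub> truncated_product m p) ` (UNIV \<times> UNIV) \<subseteq> W"
    by (intro exI[of _ n]) (auto 0 0 simp: truncated_product_def intro!: n)
qed

theorem mainTheorem5:
  "\<exists>(R :: (nat \<Rightarrow> real) ring) (TR :: (nat \<Rightarrow> real) topology)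
     (X :: (nat \<Rightarrow> real, nat \<Rightarrow> real) module) (TX :: (nat \<Rightarrow> real) topology)
     (\<sigma>s :: nat \<Rightarrow> (nat \<Rightarrow> real) \<times> (nat \<Rightarrow> real) \<Rightarrow> (nat \<Rightarrow> real))
     (\<sigma> :: (nat \<Rightarrow> real) \<times> (nat \<Rightarrow> real) \<Rightarrow> (nat \<Rightarrow> real)).
     topological_ring R TR \<and> topological_module R TR X TX \<and>
     (\<forall>k. \<sigma>s k \<in> B_n R TR X TX) \<and>
     Cauchy_on_zero_nbhds X TX \<sigma>s \<and>
     bigroup_hom X \<sigma> \<and>
     converges_on_zero_nbhds X TX \<sigma>s \<sigma> \<and>
     \<not> n_bounded R TR X TX \<sigma>"
proof (intro exI conjI allI)
  show "truncated_product k \<in> B_n seq_ring euclidean seq_module euclidean" for k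
    using bigroup_hom_truncated_product n_bounded_truncated_product by (simp add: B_n_def)
qed (rule topological_ring_seq_ring topological_module_seq_module Cauchy_truncated_product
  bigroup_hom_pointwise_product truncated_product_converges not_n_bounded_pointwise_product)+

end
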